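(* Let $m\ge2$ and suppose that a real-valued loss $L(j,\gamma)$, $j\in\{1,\ldots,m\}$, with (nonempty) action space $\mathcal A$ induces the same generalized entropy as the zero-one loss, i.e. $H_L(\eta)=1-\max_k\eta_k$ for all $\eta\in\Delta_m$. Then for all $\eta\in\Delta_m$ and $\gamma\in\mathcal A$, $$\frac1m\Big\{\sum_{j=1}^m\eta_jL^{\mathrm{zo}}(j,\sigma_L(\gamma))-H^{\mathrm{zo}}(\eta)\Big\}\le\sum_{j=1}^m\eta_jL(j,\gamma)-H_L(\eta),$$ where $\sigma_L(\gamma)=(-L(1,\gamma),\ldots,-L(m,\gamma))^{T}$. Moreover, the loss $L(j,\gamma)$, with the prediction mapping $\sigma_L$, is classification calibrated for the zero-one loss.
   Context: $\Delta_m=\{q\in\mathbb R^m: q_j\ge0,\ \sum_jq_j=1\}$. The generalized entropy is $H_L(\eta)=\inf_{\gamma\in\mathcal A}\sum_j\eta_jL(j,\gamma)$. The zero-one loss is $L^{\mathrm{zo}}(j,\gamma)=1\{j\ne\mathrm{argmax}_k\gamma_k\}$, $\gamma\in\mathbb R^m$ (argmax is a single index of a maximum component, ties broken by any fixed rule), and $H^{\mathrm{zo}}(\eta)=1-\max_k\eta_k$. A loss $L(j,\gamma)$ with action space $\mathcal A$ and prediction mapping $\sigma=(\sigma_1,\ldots,\sigma_m)^{T}:\mathcal A\to\mathbb R^m$ is classification calibrated for the zero-one loss if for any $\eta\in\Delta_m$ and $k\in\{1,\ldots,m\}$ with $\eta_k<\max_j\eta_j$, $$\inf_{\gamma\in\mathcal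 A}\Big\{\sum_{j=1}^m\eta_jL(j,\gamma)-H_L(\eta):\ \sigma_k(\gamma)=\max_{j}\sigma_j(\gamma)\Big\}>0$$ (the infimum of an empty set being $+\infty$). *)

theory Defs
  imports "HOL-Analysis.Analysis"
begin

text \<open>The labels \<open>1, \<dots>, m\<close> are the elements of a finite type \<open>'m\<close>, with \<open>m = CARD('m)\<close>.\<close>

definition prob_simplex :: "(real ^ 'm::finite) set" where
  "prob_simplex = {q. (\<forall>j. 0 \<le> q $ j) \<and> (\<Sum>j\<in>UNIV. q $ j) = 1}"

definition expected_loss :: "('m::finite \<Rightarrow> 'a \<Rightarrow> real) \<Rightarrow> real ^ 'm \<Rightarrow> 'a \<Rightarrow> real" where
  "expected_loss L \<eta> \<gamma> = (\<Sum>j\<in>UNIV. \<eta> $ j * L j \<gamma>)"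

text \<open>Infima are taken in \<^typ>\<open>ereal\<close>: a real loss may be unbounded below, and an
  infimum over the empty set is \<open>\<infinity>\<close>.\<close>

definition gen_entropy :: "'a set \<Rightarrow> ('m::finite \<Rightarrow> 'a \<Rightarrow> real) \<Rightarrow> real ^ 'm \<Rightarrow> ereal" where
  "gen_entropy A L \<eta> = (INF \<gamma>\<in>A. ereal (expected_loss L \<eta> \<gamma>))"

text \<open>A rule that selects one index of a maximal component; ties are broken arbitrarily,
  but the selection is a function of the vector.\<close>

definition argmax_rule :: "(real ^ 'm::finite \<Rightarrow> 'm) \<Rightarrow> bool" where
  "argmax_rule am \<longleftrightarrow> (\<forall>\<gamma>. \<gamma> $ am \<gamma> = Max (range (($) \<gamma>)))"

definition zero_one_loss :: "(real ^ 'm::finite \<Rightarrow> 'm) \<Rightarrow> 'm \<Rightarrow> real ^ 'm \<Rightarrow> real" where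
  "zero_one_loss am j \<gamma> = (if j \<noteq> am \<gamma> then 1 else 0)"

definition zero_one_entropy :: "real ^ 'm::finite \<Rightarrow> real" where
  "zero_one_entropy \<eta> = 1 - Max (range (($) \<eta>))"

definition classification_calibrated ::
  "'a set \<Rightarrow> ('m::finite \<Rightarrow> 'a \<Rightarrow> real) \<Rightarrow> ('a \<Rightarrow> real ^ 'm) \<Rightarrow> bool" where
  "classification_calibrated A L \<sigma> \<longleftrightarrow>
    (\<forall>\<eta>\<in>prob_simplex. \<forall>k. \<eta> $ k < Max (range (($) \<eta>)) \<longrightarrow>
      0 < (INF \<gamma>\<in>{\<gamma>\<in>A. \<sigma> \<gamma> $ k = Max (range (($) (\<sigma> \<gamma>)))}.
             ereal (expected_loss L \<eta> \<gamma>) - gen_entropy A L \<eta>))"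

definition neg_loss_prediction :: "('m::finite \<Rightarrow> 'a \<Rightarrow> real) \<Rightarrow> 'a \<Rightarrow> real ^ 'm" where
  "neg_loss_prediction L \<gamma> = (\<chi> j. - L j \<gamma>)"

lemma expected_zero_one_loss:
  assumes "\<eta> \<in> prob_simplex"
  shows "expected_loss (zero_one_loss am) \<eta> \<gamma> = 1 - \<eta> $ am \<gamma>"
proof -
  have "expected_loss (zero_one_loss am) \<eta> \<gamma> =
      (\<Sum>j\<in>UNIV. \<eta> $ j - (if j = am \<gamma> then \<eta> $ j else 0))"
    unfolding expected_loss_def zero_one_loss_def by (intro sum.cong) auto
  also have "\<dots> = 1 - \<eta> $ am \<gamma>"
    using assms by (simp add: prob_simplex_def sum_subtractf)
  finally show ?thesis .
qed

text \<open>\<^const>\<open>zero_one_entropy\<close> is the generalized entropy of the zero-one loss, whatever the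
  tie-breaking rule.\<close>

lemma gen_entropy_zero_one_loss:
  assumes "argmax_rule am" and "\<eta> \<in> prob_simplex"
  shows "gen_entropy UNIV (zero_one_loss am) \<eta> = ereal (zero_one_entropy \<eta>)"
  unfolding gen_entropy_def
proof (rule INF_eqI)
  fix \<gamma> :: "real ^ 'a"
  have "\<eta> $ am \<gamma> \<le> Max (range (($) \<eta>))"
    by (intro Max_ge) auto
  then show "ereal (zero_one_entropy \<eta>) \<le> ereal (expected_loss (zero_one_loss am) \<eta> \<gamma>)"
    using assms(2) by (simp add: expected_zero_one_loss zero_one_entropy_def)
next
  fix y assume "\<And>\<gamma>. \<gamma> \<in> UNIV \<Longrightarrow> y \<le> ereal (expected_loss (zero_one_loss am) \<eta> \<gamma>)"
  from this[of \<eta>] show "y \<le> ereal (zero_one_entropy \<eta>)"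
    using assms by (simp add: expected_zero_one_loss zero_one_entropy_def argmax_rule_def)
qed

end

theory Submission
  imports Defs
begin

text \<open>If \<open>\<sigma>\<^sub>L(\<gamma>)\<close> is maximal at \<open>k\<close>, then \<open>L(k,\<gamma>)\<close> is the smallest of the losses, so transporting
  mass of \<open>\<eta>\<close> to the label \<open>k\<close> does not increase the expected loss. With
  \<open>c = max \<eta> - (max \<eta> - \<eta>\<^sub>k)/m\<close>, cutting the other components of \<open>\<eta>\<close> down to \<open>c\<close> frees at most
  \<open>(m - 1)(max \<eta> - \<eta>\<^sub>k)/m = c - \<eta>\<^sub>k\<close>, so the transported distribution \<open>\<eta>'\<close> satisfies
  \<open>max \<eta>' \<le> c\<close>. Its expected loss is at least \<open>1 - max \<eta>' \<ge> 1 - c\<close>, which bounds the regret at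
  \<open>\<eta>\<close> below by \<open>(max \<eta> - \<eta>\<^sub>k)/m\<close>. Both claims follow.\<close>

lemma flatten_towards_component:
  fixes \<eta> :: "real ^ 'm::finite" and l :: "'m \<Rightarrow> real"
  assumes \<eta>: "\<eta> \<in> prob_simplex"
    and min: "\<And>j. l k \<le> l j"
  obtains \<eta>' where "\<eta>' \<in> prob_simplex"
    and "(\<Sum>j\<in>UNIV. \<eta>' $ j * l j) \<le> (\<Sum>j\<in>UNIV. \<eta> $ j * l j)"
    and "Max (range (($) \<eta>')) \<le>
      Max (range (($) \<eta>)) - (Max (range (($) \<eta>)) - \<eta> $ k) / real CARD('m)"
proof -
  define M m where "M = Max (range (($) \<eta>))" and "m = real CARD('m)"
  \<comment> \<open>This level solves \<open>(m - 1) * (M - c) = c - \<eta> $ k\<close>: even if all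
    other components equal \<open>M\<close>, cutting them to \<open>c\<close> raises component
    \<open>k\<close> only up to \<open>c\<close>.\<close>
  define c where "c = M - (M - \<eta> $ k) / m"
  define t where "t = (\<lambda>j. max 0 (\<eta> $ j - c))"
  define T where "T = sum t UNIV"
  define \<eta>' where "\<eta>' = (\<chi> j. \<eta> $ j - t j + (if j = k then T else 0))"
  have m: "m \<ge> 1"
    unfolding m_def using zero_less_card_finite[where 'a='m] by simp
  have le_M: "\<eta> $ j \<le> M" for j
    unfolding M_def by (intro Max_ge) auto
  have nonneg: "0 \<le> \<eta> $ j" for j
    using \<eta> by (auto simp: prob_simplex_def)
  have total: "(\<Sum>j\<in>UNIV. \<eta> $ j) = 1"
    using \<eta> by (auto simp: prob_simplex_def)
  have d: "0 \<le> (M - \<eta> $ k) / m" "(M - \<eta> $ k) / m \<le> M - \<eta> $ k"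
    using m le_M[of k] mult_left_mono[of 1 m "M - \<eta> $ k"] by (auto simp: field_simps)
  \<comment> \<open>The first bound spares component \<open>k\<close> from the cut; the second keeps
    each cut \<open>t j\<close> below \<open>\<eta> $ j\<close>, so no component becomes
    negative.\<close>
  then have c: "\<eta> $ k \<le> c" "0 \<le> c"
    using nonneg[of k] by (auto simp: c_def)
  have t: "0 \<le> t j" "t j \<le> (M - \<eta> $ k) / m" "t j \<le> \<eta> $ j" "\<eta> $ j - t j \<le> c" for j
    using le_M[of j] d nonneg[of j] c by (auto simp: t_def c_def)
  have tk: "t k = 0"
    using c by (simp add: t_def)
  have T0: "0 \<le> T"
    unfolding T_def by (intro sum_nonneg t)
  have "T = (\<Sum>j\<in>UNIV - {k}. t j)"
    unfolding T_def by (simp add: sum.remove[of UNIV k] tk)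
  also have "\<dots> \<le> real (card (UNIV - {k})) * ((M - \<eta> $ k) / m)"
    by (intro sum_bounded_above t)
  also have "\<dots> = (m - 1) * ((M - \<eta> $ k) / m)"
    using m by (simp add: m_def card_Diff_singleton of_nat_diff)
  also have "\<dots> = c - \<eta> $ k"
    using m by (simp add: c_def field_simps)
  finally have T: "\<eta> $ k + T \<le> c"
    by simp
  have "\<eta>' \<in> prob_simplex"
    using t T0 total
    by (auto simp: prob_simplex_def \<eta>'_def sum.distrib sum_subtractf T_def[symmetric]
        add_nonneg_nonneg)
  moreover have "(\<Sum>j\<in>UNIV. \<eta>' $ j * l j) \<le> (\<Sum>j\<in>UNIV. \<eta> $ j * l j)"
  proof -
    have "(\<Sum>j\<in>UNIV. \<eta>' $ j * l j) =
        (\<Sum>j\<in>UNIV. \<eta> $ j * l j - t j * l j + (if j = k then T * l k else 0))"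
      unfolding \<eta>'_def by (intro sum.cong) (auto simp: algebra_simps)
    also have "\<dots> = (\<Sum>j\<in>UNIV. \<eta> $ j * l j) - (\<Sum>j\<in>UNIV. t j * l j) + T * l k"
      by (simp add: sum.distrib sum_subtractf)
    \<comment> \<open>Each unit of mass moved from \<open>j\<close> to \<open>k\<close> trades
      \<open>l j\<close> for the minimal value \<open>l k\<close>.\<close>
    also have "T * l k \<le> (\<Sum>j\<in>UNIV. t j * l j)"
      unfolding T_def sum_distrib_right by (intro sum_mono mult_left_mono min t)
    finally show ?thesis
      by simp
  qed
  moreover have "Max (range (($) \<eta>')) \<le> c"
    using t T tk by (auto simp: \<eta>'_def)
  ultimately show thesis
    using that by (simp add: c_def M_def m_def)
qed

text \<open>Calibration concerns every maximal index, so \<open>k\<close> is not tied to a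
  tie-breaking rule. The bound depends on \<open>\<gamma>\<close> only through
  \<open>k\<close>.\<close>

lemma regret_lower_bound:
  fixes L :: "'m::finite \<Rightarrow> 'a \<Rightarrow> real"
  assumes H: "\<forall>\<eta>\<in>prob_simplex. gen_entropy A L \<eta> = ereal (1 - Max (range (($) \<eta>)))"
    and \<eta>: "\<eta> \<in> prob_simplex" and \<gamma>: "\<gamma> \<in> A"
    and k: "neg_loss_prediction L \<gamma> $ k = Max (range (($) (neg_loss_prediction L \<gamma>)))"
  shows "ereal ((Max (range (($) \<eta>)) - \<eta> $ k) / real CARD('m))
    \<le> ereal (expected_loss L \<eta> \<gamma>) - gen_entropy A L \<eta>"
proof -
  have min: "L k \<gamma> \<le> L j \<gamma>" for j
  proof -
    have "neg_loss_prediction L \<gamma> $ j \<le> neg_loss_prediction L \<gamma> $ k"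
      unfolding k by (intro Max_ge) auto
    then show ?thesis
      by (simp add: neg_loss_prediction_def)
  qed
  obtain \<eta>' where \<eta>': "\<eta>' \<in> prob_simplex"
    and loss: "expected_loss L \<eta>' \<gamma> \<le> expected_loss L \<eta> \<gamma>"
    and max: "Max (range (($) \<eta>')) \<le>
      Max (range (($) \<eta>)) - (Max (range (($) \<eta>)) - \<eta> $ k) / real CARD('m)"
    unfolding expected_loss_def
    using flatten_towards_component[where l="\<lambda>j. L j \<gamma>", OF \<eta> min] .
  \<comment> \<open>The entropy hypothesis serves twice: at \<open>\<eta>'\<close> it bounds the
    loss of this same \<open>\<gamma>\<close> from below, and at \<open>\<eta>\<close> it turns that
    bound into one on the regret.\<close>
  have "gen_entropy A L \<eta>' \<le> ereal (expected_loss L \<eta>' \<gamma>)"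
    unfolding gen_entropy_def by (intro INF_lower \<gamma>)
  then have "1 - Max (range (($) \<eta>')) \<le> expected_loss L \<eta>' \<gamma>"
    using H \<eta>' by simp
  with loss max have "(Max (range (($) \<eta>)) - \<eta> $ k) / real CARD('m)
      \<le> expected_loss L \<eta> \<gamma> - (1 - Max (range (($) \<eta>)))"
    by linarith
  then show ?thesis
    using H \<eta> by simp
qed

theorem proposition9:
  fixes A :: "'a set"
    and L :: "'m::finite \<Rightarrow> 'a \<Rightarrow> real"
    and am :: "real ^ 'm \<Rightarrow> 'm"
  assumes "CARD('m) \<ge> 2"
    and "A \<noteq> {}"
    and "argmax_rule am"
    and "\<forall>\<eta>\<in>prob_simplex. gen_entropy A L \<eta> = ereal (1 - Max (range (($) \<eta>)))"
  shows "(\<forall>\<eta>\<in>prob_simplex. \<forall>\<gamma>\<in>A.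
           ereal (1 / real CARD('m) *
             (expected_loss (zero_one_loss am) \<eta> (neg_loss_prediction L \<gamma>) - zero_one_entropy \<eta>))
           \<le> ereal (expected_loss L \<eta> \<gamma>) - gen_entropy A L \<eta>)
         \<and> classification_calibrated A L (neg_loss_prediction L)"
proof (intro conjI ballI)
  fix \<eta> :: "real ^ 'm" and \<gamma> :: 'a
  assume \<eta>: "\<eta> \<in> prob_simplex" and \<gamma>: "\<gamma> \<in> A"
  \<comment> \<open>For this index the zero-one regret is exactly
    \<open>Max (range (($) \<eta>)) - \<eta> $ ?k\<close>.\<close>
  let ?k = "am (neg_loss_prediction L \<gamma>)"
  have "neg_loss_prediction L \<gamma> $ ?k = Max (range (($) (neg_loss_prediction L \<gamma>)))"
    using assms(3) by (simp add: argmax_rule_def)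
  from regret_lower_bound[OF assms(4) \<eta> \<gamma> this]
  show "ereal (1 / real CARD('m) *
      (expected_loss (zero_one_loss am) \<eta> (neg_loss_prediction L \<gamma>) - zero_one_entropy \<eta>))
    \<le> ereal (expected_loss L \<eta> \<gamma>) - gen_entropy A L \<eta>"
    by (simp add: expected_zero_one_loss[OF \<eta>] zero_one_entropy_def)
next
  show "classification_calibrated A L (neg_loss_prediction L)"
    unfolding classification_calibrated_def
  proof (intro ballI allI impI)
    fix \<eta> :: "real ^ 'm" and k
    assume \<eta>: "\<eta> \<in> prob_simplex" and k: "\<eta> $ k < Max (range (($) \<eta>))"
    \<comment> \<open>With \<open>k\<close> fixed the bound is uniform in \<open>\<gamma>\<close>,
      so strict positivity survives the infimum, also over an empty set.\<close>
    have "0 < ereal ((Max (range (($) \<eta>)) - \<eta> $ k) / real CARD('m))"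
      using k by simp
    also have "\<dots> \<le> (INF \<gamma>\<in>{\<gamma>\<in>A. neg_loss_prediction L \<gamma> $ k =
        Max (range (($) (neg_loss_prediction L \<gamma>)))}.
        ereal (expected_loss L \<eta> \<gamma>) - gen_entropy A L \<eta>)"
      by (intro INF_greatest) (use regret_lower_bound[OF assms(4) \<eta>] in auto)
    finally show "0 < \<dots>" .
  qed
qed

end
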